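(* Let $f:H\to\mathbb{R}$ be convex and $L$-smooth ($L>0$), have $\mu$-quadratic growth ($\mu>0$) and admit a unique minimizer $x^*$; let $f^*$ be its minimum value. Set $$h=\frac{1}{\sqrt L},\qquad \gamma\in[1,2],\qquad \alpha=\frac{3+\sqrt2}{2+\sqrt2}\sqrt{\mu\gamma},\qquad q=\mu/L.$$ Given $x_0,y_0\in H$, let $(x_k)$ and $(y_k)$ be generated, for $k\ge 0$, by $$y_{k+1}=x_k-h^2\nabla f(x_k),\qquad x_{k+1}=y_{k+1}+\frac{1}{1+\alpha h}(y_{k+1}-y_k)+\left(\frac{\gamma}{1+\alpha h}-1\right)(y_{k+1}-x_k).$$ If $y_0=-\left(\gamma-\frac{\sqrt{q\gamma}}{(2+\sqrt2)(1+\sqrt{q\gamma})}\right)h^2\nabla f(x_0)+x_0$, then for every $k\ge 1$, $$f(y_k)-f^*\le\left[\frac{\sqrt2\,\mu}{2}\|x_0-x^*\|^2+\sqrt2\left(f(x_0)-f^*\right)\right](1+\rho)^{-k+1},$$ where $\rho=\frac{(2-\sqrt2)\sqrt{q\gamma}}{1+2\sqrt{q\gamma}}$. Moreover, $\sum_{k=0}^\infty(1+\rho)^k\|\nabla f(x_k)\|^2<\infty$.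
   Context: $H$ is a real Hilbert space with norm $\|\cdot\|$. $f$ is $L$-smooth if it is differentiable and $\nabla f$ is Lipschitz-continuous with constant $L$. With $S=\operatorname{argmin}(f)$ and $f^*=\min(f)$, $f$ has $\mu$-quadratic growth if $f(x)-f^*\ge\frac{\mu}{2}\operatorname{dist}(x,S)^2$ for all $x\in H$. *)

theory Defs
  imports "HOL-Analysis.Analysis"
begin

text \<open>Unspecified at points where no gradient exists; below it is only applied to differentiable
  functions on a complete space, where existence is the Riesz representation theorem.\<close>

definition grad :: "('a::real_inner \<Rightarrow> real) \<Rightarrow> 'a \<Rightarrow> 'a" where
  "grad f x = (THE D. GDERIV f x :> D)"

definition smooth_with :: "real \<Rightarrow> ('a::{real_inner, complete_space} \<Rightarrow> real) \<Rightarrow> bool" where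
  "smooth_with L f \<longleftrightarrow> (\<forall>x. f differentiable (at x)) \<and> lipschitz_on L UNIV (grad f)"

definition argmin_set :: "('a \<Rightarrow> real) \<Rightarrow> 'a set" where
  "argmin_set f = {x. is_arg_min f (\<lambda>_. True) x}"

text \<open>The infimum over the whole space; it is the minimum whenever \<^term>\<open>argmin_set f\<close> is
  nonempty, which is the only case in which it is used.\<close>

definition min_value :: "('a \<Rightarrow> real) \<Rightarrow> real" where
  "min_value f = (INF x. f x)"

text \<open>Nonemptiness of the set of minimizers is part of the definition since \<^const>\<open>infdist\<close> to the
  empty set is \<open>0\<close>.\<close>

definition quadratic_growth :: "real \<Rightarrow> ('a::metric_space \<Rightarrow> real) \<Rightarrow> bool" where
  "quadratic_growth \<mu> f \<longleftrightarrow> argmin_set f \<noteq> {} \<and>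
     (\<forall>x. f x - min_value f \<ge> \<mu> / 2 * (infdist x (argmin_set f))\<^sup>2)"

end

theory Submission
  imports Defs
begin

text \<open>Rescale to \<open>F = (f - fstar) / L\<close>, \<open>g\<^sub>k = grad f (x\<^sub>k) / L\<close>, put \<open>xstar\<close> at the origin, and let
  \<open>s = sqrt (q * \<gamma>)\<close>, \<open>\<kappa> = 1 - 1 / sqrt 2\<close>, \<open>d = \<kappa> * s\<close>, so that \<open>\<alpha> * h = s + d\<close> and
  \<open>\<rho> = 2 * d / (1 + 2 * s)\<close>. With \<open>w\<^sub>k = x\<^sub>k - y\<^sub>k\<close> and \<open>\<Phi>\<^sub>k = F (x\<^sub>k) - (norm g\<^sub>k)\<^sup>2 / 2\<close>, which dominates
  \<open>F (y\<^sub>k\<^sub>+\<^sub>1)\<close>, the Lyapunov function is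
  \<open>P * \<Phi>\<^sub>k\<^sub>-\<^sub>1 + (norm (s * x\<^sub>k + w\<^sub>k))\<^sup>2 / 2 - s * \<epsilon> / 2 * (norm y\<^sub>k)\<^sup>2\<close>.
  The constants \<open>\<epsilon>\<close> and \<open>P\<close> and the multiplier \<open>m\<close> are chosen so that, in the decrement written in the
  vectors \<open>y\<^sub>k\<^sub>+\<^sub>1\<close>, \<open>y\<^sub>k\<^sub>+\<^sub>1 - y\<^sub>k\<close>, \<open>g\<^sub>k\<close>, all mixed terms cancel against
  \<open>\<Phi>\<^sub>k - \<Phi>\<^sub>k\<^sub>-\<^sub>1 \<le> inner g\<^sub>k (y\<^sub>k\<^sub>+\<^sub>1 - y\<^sub>k)\<close> (weight \<open>P\<close>) and \<open>\<Phi>\<^sub>k \<le> inner g\<^sub>k y\<^sub>k\<^sub>+\<^sub>1\<close> (weight \<open>m\<close>); the squares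
  that remain are controlled by quadratic growth, and the one of \<open>g\<^sub>k\<close> has a strictly negative
  coefficient, which gives summability. The choice of \<open>y\<^sub>0\<close> makes \<open>s * x\<^sub>1 + w\<^sub>1 = s * x\<^sub>0\<close>.\<close>

section \<open>Gradients in Hilbert space\<close>

text \<open>The representing vector minimizes \<open>\<lambda>v. inner v v - 2 * \<phi> v\<close>; minimizing sequences are Cauchy
  by the parallelogram identity.\<close>

lemma riesz_representation:
  fixes \<phi> :: "'a::{real_inner, complete_space} \<Rightarrow> real"
  assumes "bounded_linear \<phi>"
  shows "\<exists>D. \<forall>v. \<phi> v = inner v D"
proof -
  interpret bounded_linear \<phi> by fact
  define J where "J v = inner v v - 2 * \<phi> v" for v
  obtain K where K: "\<And>v. norm (\<phi> v) \<le> norm v * K"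
    using bounded by blast
  have J_ge: "- K\<^sup>2 \<le> J v" for v
  proof -
    have "\<phi> v \<le> norm v * K" using K[of v] by simp
    then have "J v \<ge> (norm v - K)\<^sup>2 - K\<^sup>2"
      unfolding J_def by (simp add: power2_norm_eq_inner[symmetric] power2_eq_square algebra_simps)
    then show ?thesis using zero_le_power2[of "norm v - K"] by linarith
  qed
  define m where "m = (INF v. J v)"
  have bdd: "bdd_below (range J)"
    using J_ge by (auto intro!: bdd_belowI)
  have m_le: "m \<le> J v" for v
    unfolding m_def using bdd by (auto intro: cINF_lower)
  have "\<exists>v. J v < m + 1 / real (Suc n)" for n
    using cINF_less_iff[OF _ bdd, of "m + 1 / real (Suc n)"] by (auto simp: m_def)
  then obtain X where X: "\<And>n. J (X n) < m + 1 / real (Suc n)"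
    by metis
  have midpoint: "(dist u v)\<^sup>2 = 2 * J u + 2 * J v - 4 * J ((1/2) *\<^sub>R (u + v))" for u v
    unfolding J_def dist_norm power2_norm_eq_inner
    by (simp add: add scaleR inner_simps inner_commute algebra_simps)
  have "Cauchy X"
  proof (rule metric_CauchyI)
    fix e :: real assume "e > 0"
    then obtain M where M: "inverse (real (Suc M)) < e\<^sup>2 / 4"
      using reals_Archimedean[of "e\<^sup>2/4"] by auto
    have small: "J (X n) < m + e\<^sup>2 / 4" if "n \<ge> M" for n
    proof -
      have "1 / real (Suc n) \<le> 1 / real (Suc M)"
        using that by (intro divide_left_mono) auto
      then show ?thesis using X[of n] M by (simp add: inverse_eq_divide)
    qed
    have "dist (X i) (X j) < e" if "i \<ge> M" "j \<ge> M" for i j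
    proof -
      have "(dist (X i) (X j))\<^sup>2 < e\<^sup>2"
        using midpoint[of "X i" "X j"] small[OF that(1)] small[OF that(2)]
          m_le[of "(1/2) *\<^sub>R (X i + X j)"] by linarith
      then show ?thesis
        using \<open>e > 0\<close> power_less_imp_less_base[of _ 2 e] by auto
    qed
    then show "\<exists>M. \<forall>i\<ge>M. \<forall>j\<ge>M. dist (X i) (X j) < e" by blast
  qed
  then obtain D where D: "X \<longlonglongrightarrow> D"
    using Cauchy_convergent_iff convergentD by blast
  have "(\<lambda>n. J (X n)) \<longlonglongrightarrow> J D"
    unfolding J_def by (intro tendsto_intros tendsto D)
  moreover have "(\<lambda>n. m + 1 / real (Suc n)) \<longlonglongrightarrow> m + 0"
    by (intro tendsto_intros) (use LIMSEQ_inverse_real_of_nat in \<open>simp add: inverse_eq_divide\<close>)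
  ultimately have "J D \<le> m + 0"
    using X by (intro LIMSEQ_le[of "\<lambda>n. J (X n)"]) (auto intro: less_imp_le)
  then have J_min: "J D \<le> J v" for v
    using m_le[of v] by simp
  have "\<phi> v = inner v D" for v
  proof (cases "v = 0")
    case False
    define r where "r = inner v D - \<phi> v"
    \<comment> \<open>The minimizer in \<open>t\<close> of the quadratic polynomial
      \<open>J (D + t *\<^sub>R v)\<close>; it would lie below \<open>J D\<close> by
      \<open>r\<^sup>2 / inner v v\<close>, so minimality of \<open>D\<close> forces
      \<open>r = 0\<close>.\<close>
    define t where "t = - r / inner v v"
    have pos: "inner v v > 0" using False by simp
    have "J (D + t *\<^sub>R v) = J D + t\<^sup>2 * inner v v + 2 * t * r"
      unfolding J_def r_def
      by (simp add: add scaleR inner_simps inner_commute power2_eq_square algebra_simps)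
    also have "\<dots> = J D - r\<^sup>2 / inner v v"
      unfolding t_def using pos by (simp add: power2_eq_square field_simps)
    finally have "r\<^sup>2 / inner v v \<le> 0"
      using J_min[of "D + t *\<^sub>R v"] by simp
    then have "r = 0" using pos by (simp add: divide_le_0_iff)
    then show ?thesis by (simp add: r_def)
  qed (simp add: zero)
  then show ?thesis by blast
qed

lemma GDERIV_unique:
  assumes "GDERIV f x :> D" "GDERIV f x :> D'"
  shows "D = D'"
proof -
  have "(\<lambda>v. inner v D) = (\<lambda>v. inner v D')"
    using assms unfolding gderiv_def by (rule has_derivative_unique)
  then have "inner (D - D') D = inner (D - D') D'" by meson
  then have "inner (D - D') (D - D') = 0" by (simp add: inner_diff_right)
  then show ?thesis by simp
qed

lemma GDERIV_grad:
  fixes f :: "'a::{real_inner, complete_space} \<Rightarrow> real"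
  assumes "f differentiable (at x)"
  shows "GDERIV f x :> grad f x"
proof -
  obtain f' where f': "(f has_derivative f') (at x)"
    using assms by (auto simp: differentiable_def)
  then obtain D where "\<forall>v. f' v = inner v D"
    using riesz_representation[OF has_derivative_bounded_linear] by blast
  then have "f' = (\<lambda>v. inner v D)" by auto
  then have D: "GDERIV f x :> D"
    using f' by (simp add: gderiv_def)
  have "grad f x = D"
    unfolding grad_def by (rule the_equality, fact D, rule GDERIV_unique[OF _ D])
  then show ?thesis using D by simp
qed

lemma GDERIV_line:
  assumes "GDERIV f (x + t *\<^sub>R v) :> D"
  shows "((\<lambda>t. f (x + t *\<^sub>R v)) has_real_derivative inner v D) (at t)"
proof -
  have "((\<lambda>t. x + t *\<^sub>R v) has_derivative (\<lambda>s. s *\<^sub>R v)) (at t)"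
    by (auto intro!: derivative_eq_intros)
  from has_derivative_compose[OF this assms[unfolded gderiv_def]]
  show ?thesis
    by (simp add: has_field_derivative_def mult_commute_abs)
qed

text \<open>Along the segment, left side minus right side has derivative \<open>inner v (grad f (x +
  t *\<^sub>R v) - grad f x) - L * t * (norm v)\<^sup>2\<close>, which is nonpositive by
  Cauchy-Schwarz and the Lipschitz bound.\<close>

lemma smooth_upper_bound:
  assumes "smooth_with L f"
  shows "f (x + v) \<le> f x + inner v (grad f x) + L / 2 * (norm v)\<^sup>2"
proof -
  let ?\<psi> = "\<lambda>t::real. f (x + t *\<^sub>R v) - t * inner v (grad f x) - L / 2 * t\<^sup>2 * (norm v)\<^sup>2"
  have gd: "GDERIV f z :> grad f z" for z
    using assms GDERIV_grad by (auto simp: smooth_with_def)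
  have "?\<psi> 1 \<le> ?\<psi> 0"
  proof (rule DERIV_nonpos_imp_nonincreasing[of 0 1 ?\<psi>])
    fix t :: real assume "0 \<le> t" "t \<le> 1"
    have "(?\<psi> has_real_derivative
        (inner v (grad f (x + t *\<^sub>R v)) - 1 * inner v (grad f x) - L / 2 * (2 * t) * (norm v)\<^sup>2)) (at t)"
      by (intro DERIV_diff GDERIV_line gd DERIV_cmult_right DERIV_ident)
        (auto intro!: derivative_eq_intros)
    moreover have "inner v (grad f (x + t *\<^sub>R v)) - 1 * inner v (grad f x) - L / 2 * (2 * t) * (norm v)\<^sup>2 \<le> 0"
    proof -
      have "dist (grad f (x + t *\<^sub>R v)) (grad f x) \<le> L * dist (x + t *\<^sub>R v) x"
        using assms by (intro lipschitz_onD[of L UNIV]) (auto simp: smooth_with_def)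
      then have "norm (grad f (x + t *\<^sub>R v) - grad f x) \<le> L * t * norm v"
        using \<open>0 \<le> t\<close> by (simp add: dist_norm)
      then have "norm v * norm (grad f (x + t *\<^sub>R v) - grad f x) \<le> L * t * (norm v)\<^sup>2"
        using mult_left_mono[OF _ norm_ge_zero[of v]] by (fastforce simp: power2_eq_square algebra_simps)
      moreover have "inner v (grad f (x + t *\<^sub>R v) - grad f x)
          \<le> norm v * norm (grad f (x + t *\<^sub>R v) - grad f x)"
        by (rule norm_cauchy_schwarz)
      ultimately show ?thesis by (simp add: inner_diff_right)
    qed
    ultimately show "\<exists>y. (?\<psi> has_real_derivative y) (at t) \<and> y \<le> 0" by blast
  qed simp
  then show ?thesis by simp
qed

text \<open>Convexity bounds every difference quotient on the segment by
  \<open>f (x + v) - f x\<close>, and the quotients tend to \<open>inner v D\<close> from the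
  right.\<close>

lemma convex_gradient_inequality:
  fixes f :: "'a::real_inner \<Rightarrow> real"
  assumes "convex_on UNIV f" and "GDERIV f x :> D"
  shows "f x + inner v D \<le> f (x + v)"
proof -
  let ?\<phi> = "\<lambda>t::real. f (x + t *\<^sub>R v)"
  have "(?\<phi> has_real_derivative inner v D) (at 0)"
    using assms(2) by (intro GDERIV_line) simp
  then have "((\<lambda>t. (?\<phi> t - ?\<phi> 0) / t) \<longlongrightarrow> inner v D) (at_right 0)"
    by (auto simp: has_field_derivative_iff intro: filterlim_at_split[THEN iffD1, THEN conjunct2])
  moreover have "\<forall>\<^sub>F t in at_right 0. (?\<phi> t - ?\<phi> 0) / t \<le> f (x + v) - f x"
  proof (rule eventually_at_rightI[of 0 1])
    fix t :: real assume t: "t \<in> {0<..<1}"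
    have "f ((1 - t) *\<^sub>R x + t *\<^sub>R (x + v)) \<le> (1 - t) * f x + t * f (x + v)"
      using assms(1) t unfolding convex_on_def by auto
    moreover have "(1 - t) *\<^sub>R x + t *\<^sub>R (x + v) = x + t *\<^sub>R v"
      by (simp add: algebra_simps)
    ultimately show "(?\<phi> t - ?\<phi> 0) / t \<le> f (x + v) - f x"
      using t by (simp add: field_simps)
  qed simp
  ultimately have "inner v D \<le> f (x + v) - f x"
    by (rule tendsto_upperbound) simp
  then show ?thesis by simp
qed

text \<open>The smoothness bound at \<open>y\<close> and the tangent at \<open>x\<close> are compared at the gradient step from
  \<open>y\<close> for the function \<open>f - inner (grad f x)\<close>, which is minimal at \<open>x\<close>.\<close>

lemma convex_smooth_lower_bound:
  assumes "convex_on UNIV f" and "smooth_with L f" and "L > 0"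
  shows "f x + inner (y - x) (grad f x) + (norm (grad f y - grad f x))\<^sup>2 / (2 * L) \<le> f y"
proof -
  define w where "w = grad f y - grad f x"
  have "GDERIV f x :> grad f x"
    using assms(2) GDERIV_grad by (auto simp: smooth_with_def)
  from convex_gradient_inequality[OF assms(1) this, of "y - (1 / L) *\<^sub>R w - x"]
  have "f x + inner (y - x) (grad f x) - inner w (grad f x) / L \<le> f (y - (1 / L) *\<^sub>R w)"
    by (simp add: inner_simps)
  also have "\<dots> \<le> f y - inner w (grad f y) / L + (norm w)\<^sup>2 / (2 * L)"
    using smooth_upper_bound[OF assms(2), of y "- (1 / L) *\<^sub>R w"] \<open>L > 0\<close>
    by (simp add: power2_eq_square)
  also have "inner w (grad f y) = inner w (grad f x) + (norm w)\<^sup>2"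
    unfolding w_def power2_norm_eq_inner by (simp add: inner_simps)
  finally show ?thesis
    unfolding w_def[symmetric] by (simp add: add_divide_distrib)
qed

section \<open>Minimizers and the minimum value\<close>

lemma min_value_eq:
  assumes "z \<in> argmin_set f"
  shows "min_value f = f z" and "f z \<le> f x"
proof -
  have le: "f z \<le> f x" for x
    using assms by (simp add: argmin_set_def is_arg_min_linorder)
  then show "f z \<le> f x" .
  show "min_value f = f z"
    unfolding min_value_def by (rule cInf_eq_minimum) (auto intro: le)
qed

text \<open>A gradient step from \<open>z\<close> would lower \<open>f\<close> by at least
  \<open>(norm (grad f z))\<^sup>2 / (2 * L)\<close>.\<close>

lemma grad_eq_0_at_argmin:
  assumes "smooth_with L f" and "L > 0" and "z \<in> argmin_set f"
  shows "grad f z = 0"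
proof -
  have "f z \<le> f (z - (1 / L) *\<^sub>R grad f z)"
    using assms(3) by (rule min_value_eq)
  also have "\<dots> \<le> f z - (norm (grad f z))\<^sup>2 / (2 * L)"
    using smooth_upper_bound[OF assms(1), of z "- (1 / L) *\<^sub>R grad f z"] \<open>L > 0\<close>
    by (simp add: power2_eq_square power2_norm_eq_inner[symmetric] field_simps)
  finally have "(norm (grad f z))\<^sup>2 / (2 * L) \<le> 0" by simp
  then show ?thesis using \<open>L > 0\<close> by (simp add: divide_le_0_iff)
qed

section \<open>The Lyapunov function\<close>

text \<open>\<open>b\<close> and \<open>c\<close> are the coefficients of \<open>w - g\<close> and
  \<open>g\<close> in the velocity after one step. \<open>\<epsilon>\<close> is determined by
  \<open>(1 + \<rho>) * b = 1 + \<epsilon>\<close>; \<open>P\<close> and \<open>m\<close> are the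
  coefficients, up to sign, of the mixed terms with \<open>g\<close> in the decrement.\<close>

locale rate_parameters =
  fixes s \<gamma> \<kappa> d \<rho> b \<epsilon> P m c :: real
  assumes s_pos: "0 < s" and s_le: "s\<^sup>2 \<le> 2"
    and gamma: "1 \<le> \<gamma>" "\<gamma> \<le> 2"
    and kappa_def: "\<kappa> = 1 - 1 / sqrt 2"
    and d_def: "d = \<kappa> * s"
    and rho_def: "\<rho> = 2 * d / (1 + 2 * s)"
    and b_def: "b = (1 + s) / (1 + s + d)"
    and eps_def: "\<epsilon> = d / ((1 + 2 * s) * (1 + s + d))"
    and P_def: "P = \<gamma> * (1 + \<epsilon>) * b - \<epsilon> * (1 + s)"
    and m_def: "m = s * (\<gamma> * (1 + \<epsilon>) - \<rho> * (1 + s))"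
    and c_def: "c = 1 + s - \<gamma> * b"
begin

section \<open>Identities and numerical bounds for the parameters\<close>

lemma kappa: "2 * \<kappa> * (2 - \<kappa>) = 1" "29/100 < \<kappa>" "\<kappa> < 3/10"
proof -
  define r :: real where "r = sqrt (1/2)"
  have r: "2 * (r * r) = 1" by (simp add: r_def)
  have k: "\<kappa> = 1 - r" by (simp add: kappa_def r_def real_sqrt_divide)
  have "7/10 < r" "r < 71/100" unfolding r_def
    by (rule real_less_rsqrt real_less_lsqrt; simp add: power2_eq_square)+
  then show "29/100 < \<kappa>" "\<kappa> < 3/10" by (auto simp: k)
  show "2 * \<kappa> * (2 - \<kappa>) = 1" using r unfolding k by algebra
qed

lemma s_lt: "s < 1415/1000"
proof (rule power_less_imp_less_base)
  show "s ^ 2 < (1415/1000) ^ 2" using s_le by (simp add: power2_eq_square)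
qed simp

lemma d_pos: "0 < d" and d_lt: "d < 3/10 * s"
  using kappa s_pos by (auto simp: d_def)

text \<open>The denominator of \<open>\<epsilon>\<close>: as
  \<open>\<epsilon> / s * N = \<kappa>\<close>, estimates involving \<open>\<epsilon>\<close> reduce
  to polynomial ones in \<open>s\<close>.\<close>

definition "N = (1 + 2 * s) * (1 + s + d)"

lemma N_pos: "0 < N" "1 < N"
proof -
  have "1 * 1 < (1 + 2 * s) * (1 + s + d)"
    using s_pos d_pos by (intro mult_strict_mono) auto
  then show "1 < N" "0 < N" by (auto simp: N_def)
qed

lemma eps_N: "\<epsilon> * N = d" and eps_pos: "0 < \<epsilon>" and eps_less: "\<epsilon> < \<kappa> * s"
proof -
  show "\<epsilon> * N = d" "0 < \<epsilon>"
    using N_pos d_pos by (auto simp: eps_def N_def[symmetric])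
  moreover have "\<epsilon> * 1 < \<epsilon> * N"
    using N_pos \<open>0 < \<epsilon>\<close> by (intro mult_strict_left_mono) auto
  ultimately show "\<epsilon> < \<kappa> * s" by (simp add: d_def)
qed

lemma rho_pos: "0 < \<rho>"
  using d_pos s_pos by (simp add: rho_def)

lemma b_pos: "0 < b" and b_less: "b < 1" and b_eq: "b = 1 - (1 + 2 * s) * \<epsilon>"
  and rho_b: "(1 + \<rho>) * b = 1 + \<epsilon>"
  using s_pos d_pos by (simp_all add: b_def eps_def rho_def divide_simps) algebra

lemma N_eq: "N = 1 + (3 + \<kappa>) * s + 2 * (1 + \<kappa>) * s\<^sup>2"
  unfolding N_def unfolding d_def by (simp add: power2_eq_square algebra_simps)

lemma eps_over_s: "\<epsilon> / s * N = \<kappa>"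
  using eps_N s_pos by (simp add: d_def)

lemma eps_b_le: "(1 + \<epsilon>) * b \<le> 1" and eps_b_ge: "1 - \<epsilon> * (1 + 2 * s) \<le> (1 + \<epsilon>) * b"
proof -
  have "(1 + \<epsilon>) * b = 1 - \<epsilon> * (1 + 2 * s - b)"
    using b_eq by algebra
  moreover have "0 \<le> \<epsilon> * (1 + 2 * s - b)" "0 \<le> \<epsilon> * b"
    using eps_pos b_less b_pos s_pos by auto
  ultimately show "(1 + \<epsilon>) * b \<le> 1" "1 - \<epsilon> * (1 + 2 * s) \<le> (1 + \<epsilon>) * b"
    by (auto simp: algebra_simps)
qed

text \<open>The bound that fixes \<open>\<kappa>\<close>: as \<open>s\<close> tends to 0,
  \<open>\<epsilon> / s\<close> tends to \<open>\<kappa>\<close> and the inequality becomes the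
  equality \<open>2 * \<kappa> * (2 - \<kappa>) = 1\<close>. For positive \<open>s\<close> there is
  slack.\<close>

lemma polynomial_bound: "2 * \<kappa> * ((1 + s) * s + 2 - \<epsilon> / s) \<le> 1 + 2 * s"
proof -
  have s2: "0 < s\<^sup>2" "s\<^sup>2 \<le> 1415/1000 * s"
    using s_pos s_lt by (auto simp: power2_eq_square)
  \<comment> \<open>After multiplication by \<open>N\<close> and replacement of the remaining
    \<open>\<kappa>\<close> by 3/10, the claim is
    \<open>(N - 1) / 5 \<le> s * (14/10 - 6/10 * s) * N\<close>. Fact 1 bounds the right side from
    below by one fifth of the bound on \<open>N - 1\<close> in fact 2.\<close>
  have expand: "(14/10 - 6/10 * s) * (1 + 3 * s) = 14/10 + 36/10 * s - 18/10 * s\<^sup>2"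
    by (simp add: power2_eq_square field_simps)
  have "1 + 3 * s \<le> N"
    using kappa s_pos by (simp add: N_eq algebra_simps)
  then have "(14/10 - 6/10 * s) * (1 + 3 * s) \<le> (14/10 - 6/10 * s) * N"
    using s_lt by (intro mult_left_mono) auto
  then have 1: "66/100 + 52/100 * s \<le> (14/10 - 6/10 * s) * N"
    unfolding expand using s2 s_pos s_lt by linarith
  have "(3 + \<kappa>) * s \<le> 33/10 * s" "2 * (1 + \<kappa>) * s\<^sup>2 \<le> 26/10 * s\<^sup>2"
    using kappa s2 s_pos by (intro mult_right_mono; simp)+
  then have 2: "N - 1 \<le> s * (33/10 + 26/10 * s)"
    by (simp add: N_eq power2_eq_square algebra_simps)
  have "2 * \<kappa> * ((1 + s) * s * N) \<le> 6/10 * ((1 + s) * s * N)"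
    using kappa s_pos N_pos by (intro mult_right_mono) auto
  moreover have "4 * \<kappa> * (N - 1) \<le> 12/10 * (N - 1)"
    using kappa N_pos by (intro mult_right_mono) auto
  moreover have "2 * \<kappa> * ((1 + s) * s + 2 - \<epsilon> / s) * N
      = 2 * \<kappa> * ((1 + s) * s * N) + 4 * \<kappa> * (N - 1) + 1"
  proof -
    have "2 * \<kappa> * ((1 + s) * s + 2 - \<epsilon> / s) * N
        = 2 * \<kappa> * ((1 + s) * s * N) + 4 * \<kappa> * N - 2 * \<kappa> * (\<epsilon> / s * N)"
      by (simp only: algebra_simps)
    also have "\<dots> = 2 * \<kappa> * ((1 + s) * s * N) + (4 * \<kappa> * N - 2 * \<kappa> * \<kappa>)"
      by (simp only: eps_over_s add_diff_eq)
    \<comment> \<open>The constant term must be exactly 1, so the identity for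
      \<open>\<kappa>\<close> is applied before any rounding.\<close>
    also have "4 * \<kappa> * N - 2 * \<kappa> * \<kappa> = 4 * \<kappa> * (N - 1) + 1"
      using kappa(1) by (simp add: algebra_simps)
    finally show ?thesis by (simp only: add.assoc)
  qed
  ultimately have "2 * \<kappa> * ((1 + s) * s + 2 - \<epsilon> / s) * N
      \<le> 6/10 * ((1 + s) * s * N) + 12/10 * (N - 1) + 1"
    by linarith
  also have "\<dots> \<le> (1 + 2 * s) * N"
  proof -
    have "s * (66/100 + 52/100 * s) \<le> s * ((14/10 - 6/10 * s) * N)"
      using 1 s_pos by (intro mult_left_mono) auto
    then show ?thesis using 2 by (simp add: field_simps)
  qed
  finally have "2 * \<kappa> * ((1 + s) * s + 2 - \<epsilon> / s) * N \<le> (1 + 2 * s) * N" .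
  then show ?thesis using N_pos by simp
qed

text \<open>Lets the surplus \<open>m - \<rho> * P\<close> in front of \<open>\<Phi>'\<close> pay,
  through quadratic growth, for the positive square of \<open>y'\<close> in the decrement. Dividing
  by \<open>s\<close> and using \<open>(1 + \<epsilon>) * b \<le> 1\<close> and
  \<open>1 \<le> \<gamma>\<close> reduces it to \<open>polynomial_bound\<close>.\<close>

lemma growth_coefficient: "\<gamma> * \<rho> * (s - \<epsilon>) \<le> (m - \<rho> * P) * s"
proof -
  have "(1 + s) * (s - \<epsilon>) \<le> \<gamma> * ((1 + s) * s)"
  proof -
    have "(1 + s) * (s - \<epsilon>) \<le> (1 + s) * s"
      using eps_pos s_pos by (intro mult_left_mono) auto
    also have "\<dots> \<le> \<gamma> * ((1 + s) * s)"
      using gamma s_pos by simp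
    finally show ?thesis .
  qed
  moreover have "\<gamma> * ((1 + \<epsilon>) * b) \<le> \<gamma> * 1"
    using gamma eps_b_le by (intro mult_left_mono) auto
  ultimately have "\<gamma> * (1 - \<epsilon> / s) + \<gamma> * ((1 + \<epsilon>) * b) + (1 + s) * (s - \<epsilon>)
      \<le> \<gamma> * ((1 + s) * s + 2 - \<epsilon> / s)"
    by (simp add: algebra_simps)
  then have "\<rho> * (\<gamma> * (1 - \<epsilon> / s) + \<gamma> * ((1 + \<epsilon>) * b) + (1 + s) * (s - \<epsilon>))
      \<le> \<rho> * (\<gamma> * ((1 + s) * s + 2 - \<epsilon> / s))"
    using rho_pos by (intro mult_left_mono) auto
  also have "\<dots> = \<gamma> * s / (1 + 2 * s) * (2 * \<kappa> * ((1 + s) * s + 2 - \<epsilon> / s))"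
    by (simp add: rho_def d_def)
  also have "\<dots> \<le> \<gamma> * s / (1 + 2 * s) * (1 + 2 * s)"
    using polynomial_bound gamma s_pos by (intro mult_left_mono) auto
  also have "\<dots> \<le> s * \<gamma> * (1 + \<epsilon>)"
    using gamma s_pos eps_pos by simp
  finally have "\<gamma> * \<rho> * (1 - \<epsilon> / s) \<le> m - \<rho> * P"
    by (simp add: m_def P_def algebra_simps)
  then have "\<gamma> * \<rho> * (1 - \<epsilon> / s) * s \<le> (m - \<rho> * P) * s"
    using s_pos by (intro mult_right_mono) auto
  then show ?thesis using s_pos by (simp add: algebra_simps)
qed

text \<open>\<open>P - \<gamma> * \<epsilon> / s\<close> is what remains in front of
  \<open>\<Phi>\<close> once growth has absorbed the negative square in the energy. The value
  \<open>1 - \<kappa> = 1 / sqrt 2\<close> is the source of the factor \<open>sqrt 2\<close> in the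
  rate.\<close>

lemma lower_coefficient: "\<gamma> * (1 - \<kappa>) \<le> P - \<gamma> * \<epsilon> / s"
proof -
  have "(1 - 2 * \<kappa>) * s\<^sup>2 \<le> 42/100 * s\<^sup>2" "s\<^sup>2 \<le> 1415/1000 * s" "s \<le> (1 + \<kappa>) * s"
    using kappa s_pos s_lt by (auto simp: power2_eq_square)
  moreover have "N - 1 - s * (1 + 2 * s) - s * (1 + s) = (1 + \<kappa>) * s - (1 - 2 * \<kappa>) * s\<^sup>2"
    by (simp add: N_eq algebra_simps power2_eq_square)
  ultimately have "s * (1 + s) \<le> N - 1 - s * (1 + 2 * s)"
    using s_pos by linarith
  then have "\<epsilon> / s * (s * (1 + s)) \<le> \<epsilon> / s * (N - 1 - s * (1 + 2 * s))"
    using eps_pos s_pos by (intro mult_left_mono) auto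
  then have "\<epsilon> * (1 + s) \<le> \<kappa> - \<epsilon> / s - \<epsilon> * (1 + 2 * s)"
    using eps_over_s s_pos by (simp add: right_diff_distrib)
  also have "\<dots> \<le> (1 + \<epsilon>) * b - \<epsilon> / s - 1 + \<kappa>"
    using eps_b_ge by simp
  finally have *: "\<epsilon> * (1 + s) \<le> (1 + \<epsilon>) * b - \<epsilon> / s - 1 + \<kappa>" .
  have "0 \<le> \<epsilon> * (1 + s)" using eps_pos s_pos by simp
  then have "\<epsilon> * (1 + s) \<le> \<gamma> * (\<epsilon> * (1 + s))"
    using gamma by (simp add: mult_le_cancel_right1)
  also have "\<dots> \<le> \<gamma> * ((1 + \<epsilon>) * b - \<epsilon> / s - 1 + \<kappa>)"
    using * gamma by (intro mult_left_mono) auto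
  finally show ?thesis by (simp add: P_def algebra_simps)
qed

lemma upper_coefficient: "P \<le> \<gamma>"
proof -
  have "\<gamma> * ((1 + \<epsilon>) * b) \<le> \<gamma> * 1"
    using gamma eps_b_le by (intro mult_left_mono) auto
  moreover have "0 \<le> \<epsilon> * (1 + s)" using eps_pos s_pos by simp
  ultimately show ?thesis by (simp add: P_def mult.assoc)
qed

text \<open>With \<open>t = s + d\<close> and \<open>p = 1 + t - \<gamma>\<close> this is
  \<open>(1 + 2 * t) * p\<^sup>2 < (1 + t)\<^sup>2 * (1 + 2 * s)\<close>, so
  \<open>p\<^sup>2 < 1 + 2 * s\<close> suffices: \<open>\<gamma> \<ge> 1\<close> gives
  \<open>p \<le> t\<close>, and \<open>\<gamma> \<le> 2\<close> gives \<open>p > -1\<close>.\<close>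

lemma gradient_coefficient: "(1 + \<rho>) * c\<^sup>2 < (1 + s)\<^sup>2"
proof -
  define t where "t = s + d"
  define p where "p = 1 + t - \<gamma>"
  have t: "0 < t" "t < 13/10 * s" using s_pos d_pos d_lt by (auto simp: t_def)
  have "p\<^sup>2 < 1 + 2 * s"
  proof (cases "p \<ge> 0")
    case True
    then have "p\<^sup>2 \<le> (13/10 * s)\<^sup>2"
      using t gamma by (intro power_mono) (auto simp: p_def)
    also have "\<dots> = 169/100 * (s * s)" by (simp add: power2_eq_square)
    also have "\<dots> \<le> 169/100 * (1415/1000 * s)"
      using s_pos s_lt by (intro mult_left_mono mult_right_mono) auto
    also have "\<dots> < 1 + 2 * s" using s_lt by simp
    finally show ?thesis .
  next
    case False
    then have "\<bar>p\<bar> \<le> 1" using t gamma by (auto simp: p_def)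
    then have "p\<^sup>2 \<le> 1" by (simp add: abs_square_le_1)
    then show ?thesis using s_pos by simp
  qed
  then have "(1 + 2 * t) * p\<^sup>2 < (1 + 2 * t) * (1 + 2 * s)"
    using t by (intro mult_strict_left_mono) auto
  also have "\<dots> \<le> (1 + t)\<^sup>2 * (1 + 2 * s)"
    using t s_pos by (intro mult_right_mono) (auto simp: power2_eq_square algebra_simps)
  finally have *: "(1 + 2 * t) * p\<^sup>2 / ((1 + t)\<^sup>2 * (1 + 2 * s)) < 1"
    using t s_pos by (simp add: divide_less_eq)
  have "c = (1 + s) * p / (1 + t)"
    using t by (simp add: c_def b_def p_def t_def field_simps)
  moreover have "1 + \<rho> = (1 + 2 * t) / (1 + 2 * s)"
    using s_pos by (simp add: rho_def t_def field_simps)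
  ultimately have "(1 + \<rho>) * c\<^sup>2 = (1 + s)\<^sup>2 * ((1 + 2 * t) * p\<^sup>2 / ((1 + t)\<^sup>2 * (1 + 2 * s)))"
    by (simp add: power_divide power_mult_distrib mult_ac)
  also have "\<dots> < (1 + s)\<^sup>2 * 1"
    using * s_pos by (intro mult_strict_left_mono) auto
  finally show ?thesis by simp
qed

section \<open>One-step decrease and two-sided bounds of the energy\<close>

definition energy :: "real \<Rightarrow> 'a::real_inner \<Rightarrow> 'a \<Rightarrow> real" where
  "energy \<Phi> y w = P * \<Phi> + (norm (s *\<^sub>R y + (1 + s) *\<^sub>R w))\<^sup>2 / 2 - s * \<epsilon> / 2 * (norm y)\<^sup>2"

text \<open>The state is \<open>y\<close>, \<open>w\<close> with \<open>x = y + w\<close>, so the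
  velocity in the energy is \<open>s *\<^sub>R x + w\<close>; \<open>g\<close> is the gradient at
  \<open>x\<close>, and \<open>\<Phi>\<close> belongs to the preceding index.\<close>

lemma energy_decrease:
  fixes y w g :: "'a::real_inner"
  defines "y' \<equiv> y + (w - g)"
  defines "w' \<equiv> (1 / (1 + s + d)) *\<^sub>R (w - g - \<gamma> *\<^sub>R g) + g"
  assumes descent: "\<Phi>' - \<Phi> \<le> inner g (w - g)"
    and convexity: "\<Phi>' \<le> inner g y'"
    and growth: "s\<^sup>2 / (2 * \<gamma>) * (norm y')\<^sup>2 \<le> \<Phi>'"
  shows "(1 + \<rho>) * energy \<Phi>' y' w' + ((1 + s)\<^sup>2 - (1 + \<rho>) * c\<^sup>2) / 2 * (norm g)\<^sup>2 \<le> energy \<Phi> y w"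
proof -
  define u where "u = w - g"
  have w: "w = u + g" and y: "y = y' - u" by (auto simp: u_def y'_def)
  have ab: "(1 + s) * (1 / (1 + s + d)) = b" by (simp add: b_def)
  have velocity': "s *\<^sub>R y' + (1 + s) *\<^sub>R w' = s *\<^sub>R y' + b *\<^sub>R u + c *\<^sub>R g"
  proof -
    have "(1 + s) *\<^sub>R w' = ((1 + s) * (1 / (1 + s + d))) *\<^sub>R (u - \<gamma> *\<^sub>R g) + (1 + s) *\<^sub>R g"
      unfolding w'_def u_def by (simp only: scaleR_add_right scaleR_scaleR)
    also have "\<dots> = b *\<^sub>R u + c *\<^sub>R g"
      unfolding ab c_def by (simp add: algebra_simps)
    finally show ?thesis by (simp add: add.assoc)
  qed
  have velocity: "s *\<^sub>R y + (1 + s) *\<^sub>R w = s *\<^sub>R y' + u + (1 + s) *\<^sub>R g"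
    unfolding w y by (simp add: algebra_simps)
  define YY UU GG YU YG UG where "YY = inner y' y'" "UU = inner u u" "GG = inner g g"
    "YU = inner y' u" "YG = inner y' g" "UG = inner u g"
  note names = this
  have V': "(norm (s *\<^sub>R y' + (1 + s) *\<^sub>R w'))\<^sup>2
      = s\<^sup>2 * YY + b\<^sup>2 * UU + c\<^sup>2 * GG + 2 * s * b * YU + 2 * s * c * YG + 2 * b * c * UG"
    unfolding velocity' power2_norm_eq_inner names
    by (simp add: inner_simps inner_commute power2_eq_square algebra_simps)
  have V: "(norm (s *\<^sub>R y + (1 + s) *\<^sub>R w))\<^sup>2
      = s\<^sup>2 * YY + UU + (1 + s)\<^sup>2 * GG + 2 * s * YU + 2 * s * (1 + s) * YG + 2 * (1 + s) * UG"
    unfolding velocity power2_norm_eq_inner names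
    by (simp add: inner_simps inner_commute power2_eq_square algebra_simps)
  have Y: "(norm y)\<^sup>2 = YY - 2 * YU + UU" "(norm y')\<^sup>2 = YY" "(norm g)\<^sup>2 = GG"
    unfolding y power2_norm_eq_inner names
    by (simp_all add: inner_simps inner_commute algebra_simps)
  \<comment> \<open>No \<open>YU\<close> term appears: its coefficient vanishes by
    \<open>rho_b\<close>. Descent with weight \<open>P\<close> will remove \<open>UG\<close>,
    convexity with weight \<open>m\<close> will remove \<open>YG\<close>.\<close>
  have quadratic: "(1 + \<rho>) * (2 * energy \<Phi>' y' w') - 2 * energy \<Phi> y w
      = 2 * P * ((1 + \<rho>) * \<Phi>' - \<Phi>) + \<rho> * s * (s - \<epsilon>) * YY - \<epsilon> * (1 + s - b) * UU
        - 2 * m * YG - 2 * P * UG - ((1 + s)\<^sup>2 - (1 + \<rho>) * c\<^sup>2) * GG"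
  proof -
    have E: "2 * energy \<Phi>' y' w' = 2 * P * \<Phi>' + (s\<^sup>2 * YY + b\<^sup>2 * UU + c\<^sup>2 * GG + 2 * s * b * YU
        + 2 * s * c * YG + 2 * b * c * UG) - s * \<epsilon> * YY"
      unfolding energy_def V' Y by simp
    have E': "2 * energy \<Phi> y w = 2 * P * \<Phi> + (s\<^sup>2 * YY + UU + (1 + s)\<^sup>2 * GG + 2 * s * YU
        + 2 * s * (1 + s) * YG + 2 * (1 + s) * UG) - s * \<epsilon> * (YY - 2 * YU + UU)"
      unfolding energy_def V Y by (simp add: field_simps)
    have uu: "(1 + \<rho>) * b\<^sup>2 - 1 + s * \<epsilon> = - (\<epsilon> * (1 + s - b))"
      using rho_b b_eq by algebra
    have yu: "(1 + \<rho>) * (s * b) - s - s * \<epsilon> = 0"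
      using rho_b by algebra
    have yg: "(1 + \<rho>) * (s * c) - s * (1 + s) = - m"
      unfolding m_def c_def using rho_b by algebra
    have ug: "(1 + \<rho>) * (b * c) - (1 + s) = - P"
      unfolding P_def c_def using rho_b by algebra
    show ?thesis unfolding E E' using uu yu yg ug by algebra
  qed
  have P_pos: "0 \<le> P"
  proof -
    have "0 \<le> \<gamma> * (1 - \<kappa>)" "0 \<le> \<gamma> * \<epsilon> / s" using kappa gamma eps_pos s_pos by auto
    then show ?thesis using lower_coefficient by linarith
  qed
  have "P * (\<Phi>' - \<Phi>) \<le> P * UG"
    using descent P_pos by (intro mult_left_mono) (auto simp: names u_def inner_commute)
  moreover have "0 \<le> \<epsilon> * (1 + s - b) * UU"
    using eps_pos b_less s_pos by (simp add: names)
  \<comment> \<open>Of the weight \<open>m\<close> on \<open>\<Phi>'\<close>, the part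
    \<open>\<rho> * P\<close> covers the first summand and the rest covers the square by growth. The
    rest is nonnegative because \<open>\<epsilon> < s\<close>.\<close>
  moreover have "P * \<rho> * \<Phi>' + \<rho> * s * (s - \<epsilon>) / 2 * YY \<le> m * YG"
  proof -
    have "\<kappa> * s < 1 * s"
      using kappa s_pos by (intro mult_strict_right_mono) auto
    then have eps_s: "\<epsilon> < s" using eps_less by simp
    have "0 \<le> \<gamma> * \<rho> * (s - \<epsilon>)" using gamma rho_pos eps_s by simp
    then have "0 \<le> (m - \<rho> * P) * s" using growth_coefficient by linarith
    then have mP: "0 \<le> m - \<rho> * P" using s_pos by (simp add: zero_le_mult_iff)
    moreover have "0 \<le> \<rho> * P" using rho_pos P_pos by simp
    ultimately have "0 \<le> m" by linarith
    have "\<rho> * s * (s - \<epsilon>) / 2 * YY = \<gamma> * \<rho> * (s - \<epsilon>) * (s / (2 * \<gamma>) * YY)"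
      using gamma by simp
    also have "\<dots> \<le> (m - \<rho> * P) * s * (s / (2 * \<gamma>) * YY)"
      using growth_coefficient s_pos gamma by (intro mult_right_mono) (auto simp: names)
    also have "\<dots> = (m - \<rho> * P) * (s\<^sup>2 / (2 * \<gamma>) * (norm y')\<^sup>2)"
      unfolding Y(2) by (simp add: power2_eq_square)
    also have "\<dots> \<le> (m - \<rho> * P) * \<Phi>'"
      using growth mP by (intro mult_left_mono) auto
    finally have "P * \<rho> * \<Phi>' + \<rho> * s * (s - \<epsilon>) / 2 * YY \<le> m * \<Phi>'"
      by (simp add: algebra_simps)
    also have "\<dots> \<le> m * YG"
      using convexity \<open>0 \<le> m\<close> by (intro mult_left_mono) (auto simp: names inner_commute)
    finally show ?thesis .
  qed
  ultimately show ?thesis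
    using quadratic unfolding Y by (simp add: field_simps)
qed

lemma energy_lower_bound:
  assumes "s\<^sup>2 / (2 * \<gamma>) * (norm y)\<^sup>2 \<le> \<Phi>"
  shows "\<gamma> * (1 - \<kappa>) * \<Phi> \<le> energy \<Phi> y w"
proof -
  have "0 \<le> s\<^sup>2 / (2 * \<gamma>) * (norm y)\<^sup>2" using gamma by simp
  then have "0 \<le> \<Phi>" using assms by linarith
  have "s * \<epsilon> / 2 * (norm y)\<^sup>2 = \<gamma> * \<epsilon> / s * (s\<^sup>2 / (2 * \<gamma>) * (norm y)\<^sup>2)"
    using gamma s_pos by (simp add: power2_eq_square)
  also have "\<dots> \<le> \<gamma> * \<epsilon> / s * \<Phi>"
    using assms gamma eps_pos s_pos by (intro mult_left_mono) auto
  finally have "s * \<epsilon> / 2 * (norm y)\<^sup>2 \<le> \<gamma> * \<epsilon> / s * \<Phi>" .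
  moreover have "0 \<le> (norm (s *\<^sub>R y + (1 + s) *\<^sub>R w))\<^sup>2 / 2" by simp
  ultimately have "(P - \<gamma> * \<epsilon> / s) * \<Phi> \<le> energy \<Phi> y w"
    unfolding energy_def left_diff_distrib by linarith
  moreover have "\<gamma> * (1 - \<kappa>) * \<Phi> \<le> (P - \<gamma> * \<epsilon> / s) * \<Phi>"
    using lower_coefficient \<open>0 \<le> \<Phi>\<close> by (intro mult_right_mono)
  ultimately show ?thesis by linarith
qed

lemma energy_upper_bound:
  assumes "0 \<le> \<Phi>"
  shows "energy \<Phi> y w \<le> \<gamma> * \<Phi> + (norm (s *\<^sub>R y + (1 + s) *\<^sub>R w))\<^sup>2 / 2"
proof -
  have "P * \<Phi> \<le> \<gamma> * \<Phi>" using upper_coefficient assms by (intro mult_right_mono)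
  moreover have "0 \<le> s * \<epsilon> / 2 * (norm y)\<^sup>2" using s_pos eps_pos by simp
  ultimately show ?thesis by (simp add: energy_def)
qed

end

section \<open>From the one-step decrease to rate and summability\<close>

lemma weighted_decrease:
  fixes E e :: "nat \<Rightarrow> real"
  assumes "0 \<le> r" and step: "\<And>k. r * E (Suc k) + e k \<le> E k"
    and "\<And>k. 0 \<le> E k" and "\<And>k. 0 \<le> e k"
  shows "r ^ k * E k \<le> E 0" and "summable (\<lambda>k. r ^ k * e k)"
proof -
  \<comment> \<open>The step multiplied by \<open>r ^ k\<close> telescopes; this one bound yields
    both conclusions.\<close>
  have *: "r ^ k * E k + (\<Sum>i<k. r ^ i * e i) \<le> E 0" for k
  proof (induction k)
    case (Suc k)
    have "r ^ k * (r * E (Suc k) + e k) \<le> r ^ k * E k"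
      using step assms(1) by (intro mult_left_mono) auto
    then show ?case using Suc by (simp add: algebra_simps)
  qed simp
  have nonneg: "0 \<le> r ^ k * E k" "0 \<le> r ^ k * e k" for k
    using assms by auto
  have "0 \<le> (\<Sum>i<k. r ^ i * e i)"
    using nonneg by (intro sum_nonneg) auto
  then show "r ^ k * E k \<le> E 0" using *[of k] by linarith
  show "summable (\<lambda>k. r ^ k * e k)"
  proof (rule summableI_nonneg_bounded)
    show "(\<Sum>i<n. r ^ i * e i) \<le> E 0" for n
      using *[of n] nonneg(1)[of n] by linarith
  qed (use nonneg in auto)
qed

theorem theorem14:
  fixes f :: "'a::{real_inner, complete_space} \<Rightarrow> real"
    and L \<mu> \<gamma> h \<alpha> q \<rho> fstar :: real
    and xstar :: 'a
    and x y :: "nat \<Rightarrow> 'a"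
  assumes "convex_on UNIV f"
    and "L > 0" and "smooth_with L f"
    and "\<mu> > 0" and "quadratic_growth \<mu> f"
    and "argmin_set f = {xstar}"
    and "fstar = min_value f"
    and "h = 1 / sqrt L"
    and "\<gamma> \<in> {1..2}"
    and "\<alpha> = (3 + sqrt 2) / (2 + sqrt 2) * sqrt (\<mu> * \<gamma>)"
    and "q = \<mu> / L"
    and "\<rho> = (2 - sqrt 2) * sqrt (q * \<gamma>) / (1 + 2 * sqrt (q * \<gamma>))"
    and "\<And>k. y (Suc k) = x k - h\<^sup>2 *\<^sub>R grad f (x k)"
    and "\<And>k. x (Suc k) = y (Suc k) + (1 / (1 + \<alpha> * h)) *\<^sub>R (y (Suc k) - y k)
                 + (\<gamma> / (1 + \<alpha> * h) - 1) *\<^sub>R (y (Suc k) - x k)"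
    and "y 0 = - (((\<gamma> - sqrt (q * \<gamma>) / ((2 + sqrt 2) * (1 + sqrt (q * \<gamma>)))) * h\<^sup>2) *\<^sub>R grad f (x 0)) + x 0"
  shows "(\<forall>k\<ge>1. f (y k) - fstar
            \<le> (sqrt 2 * \<mu> / 2 * (norm (x 0 - xstar))\<^sup>2 + sqrt 2 * (f (x 0) - fstar))
                * (1 + \<rho>) powi (- int k + 1))
         \<and> summable (\<lambda>k. (1 + \<rho>) ^ k * (norm (grad f (x k)))\<^sup>2)"
proof (cases "\<forall>z. z = xstar")
  \<comment> \<open>In a one-point space both claims are trivial, while \<open>\<mu> \<le> L\<close>
    may fail there.\<close>
  case True
  then have "z = z'" for z z' :: 'a by metis
  then have "grad f (x k) = 0" "y k = xstar" "x 0 = xstar" for k by blast+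
  then show ?thesis
    using min_value_eq(1)[of xstar f] assms(6,7) by simp
next
  case False
  then obtain z0 where z0: "z0 \<noteq> xstar" by blast
  have fstar: "fstar = f xstar"
    using min_value_eq(1)[of xstar f] assms(6,7) by simp
  have grad0: "grad f xstar = 0"
    using grad_eq_0_at_argmin[OF assms(3,2)] assms(6) by simp
  have growth: "\<mu> / 2 * (norm (z - xstar))\<^sup>2 \<le> f z - fstar" for z
    using assms(5,6,7) by (simp add: quadratic_growth_def dist_norm)
  have h2: "h\<^sup>2 = 1 / L"
    using assms(2,8) by (simp add: power_divide)
  have gamma: "1 \<le> \<gamma>" "\<gamma> \<le> 2" using assms(9) by auto

  \<comment> \<open>Growth and smoothness at \<open>xstar\<close> squeeze
    \<open>f z0 - fstar\<close>; hence \<open>q \<le> 1\<close>, which gives the bound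
    \<open>s\<^sup>2 \<le> 2\<close>.\<close>
  have "\<mu> / 2 * (norm (z0 - xstar))\<^sup>2 \<le> L / 2 * (norm (z0 - xstar))\<^sup>2"
    using growth[of z0] smooth_upper_bound[OF assms(3), of xstar "z0 - xstar"]
    by (simp add: grad0 fstar)
  then have "\<mu> \<le> L" using z0 by simp
  then have q: "0 < q" "q \<le> 1" using assms(2,4,11) by auto

  define s where "s = sqrt (q * \<gamma>)"
  define \<kappa> :: real where "\<kappa> = 1 - 1 / sqrt 2"
  define d where "d = \<kappa> * s"
  define b where "b = (1 + s) / (1 + s + d)"
  define \<epsilon> where "\<epsilon> = d / ((1 + 2 * s) * (1 + s + d))"
  define P where "P = \<gamma> * (1 + \<epsilon>) * b - \<epsilon> * (1 + s)"
  define m where "m = s * (\<gamma> * (1 + \<epsilon>) - \<rho> * (1 + s))"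
  define c where "c = 1 + s - \<gamma> * b"
  have s2: "s\<^sup>2 = q * \<gamma>" using q gamma by (simp add: s_def)
  have kappa_alt: "\<kappa> = 1 - sqrt 2 / 2"
    by (simp add: \<kappa>_def field_simps)
  have root2: "2 + sqrt 2 \<noteq> (0::real)" using real_sqrt_ge_zero[of 2] by linarith
  have "rate_parameters s \<gamma> \<kappa> d \<rho> b \<epsilon> P m c"
  proof
    show "0 < s" using q gamma by (simp add: s_def)
    show "s\<^sup>2 \<le> 2" using mult_mono[of q 1 \<gamma> 2] q gamma by (simp add: s2)
    have "2 * \<kappa> = 2 - sqrt 2" by (simp add: \<kappa>_def field_simps)
    then show "\<rho> = 2 * d / (1 + 2 * s)"
      using assms(12) by (simp add: s_def[symmetric] d_def)
  qed (fact gamma \<kappa>_def d_def b_def \<epsilon>_def P_def m_def c_def)+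
  then interpret rate_parameters s \<gamma> \<kappa> d \<rho> b \<epsilon> P m c .

  have alpha: "\<alpha> * h = s + d"
  proof -
    have "3 + sqrt 2 = (1 + \<kappa>) * (2 + sqrt 2)"
      by (simp add: kappa_alt field_simps)
    then have "(3 + sqrt 2) / (2 + sqrt 2) = 1 + \<kappa>"
      by (simp only: nonzero_mult_div_cancel_right[OF root2])
    moreover have "sqrt (\<mu> * \<gamma>) * h = s"
      by (simp add: assms(8) s_def assms(11) real_sqrt_divide real_sqrt_mult)
    ultimately show ?thesis
      unfolding assms(10) d_def by (simp add: algebra_simps)
  qed

  define G where "G z = h\<^sup>2 *\<^sub>R grad f z" for z
  define F where "F z = h\<^sup>2 * (f z - fstar)" for z
  define \<Phi> where "\<Phi> k = F (x k) - (norm (G (x k)))\<^sup>2 / 2" for k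
  define w where "w k = x k - y k" for k
  have y_Suc: "y (Suc k) = x k - G (x k)" for k
    using assms(13) by (simp add: G_def)
  have w_Suc: "w (Suc k) = (1 / (1 + s + d)) *\<^sub>R (w k - G (x k) - \<gamma> *\<^sub>R G (x k)) + G (x k)" for k
  proof -
    have "x (Suc k) = y (Suc k) + (1 / (1 + s + d)) *\<^sub>R (y (Suc k) - y k)
        + (\<gamma> * (1 / (1 + s + d)) - 1) *\<^sub>R (y (Suc k) - x k)"
      using assms(14)[of k] alpha by (simp add: add.assoc)
    then show ?thesis
      unfolding w_def y_Suc by (simp add: algebra_simps)
  qed
  have F_lower: "F z + inner (z' - z) (G z) + (norm (G z' - G z))\<^sup>2 / 2 \<le> F z'" for z z'
  proof -
    have "G z' - G z = h\<^sup>2 *\<^sub>R (grad f z' - grad f z)"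
      by (simp add: G_def scaleR_diff_right)
    then have "(norm (G z' - G z))\<^sup>2 = h\<^sup>2 * ((norm (grad f z' - grad f z))\<^sup>2 / L)"
      by (simp add: h2 power_mult_distrib power2_eq_square[of "1 / L"] power_divide) (simp add: power2_eq_square)
    then have "F z + inner (z' - z) (G z) + (norm (G z' - G z))\<^sup>2 / 2
      = h\<^sup>2 * (f z + inner (z' - z) (grad f z) + (norm (grad f z' - grad f z))\<^sup>2 / (2 * L) - fstar)"
      by (simp add: F_def G_def algebra_simps)
    also have "\<dots> \<le> F z'"
      unfolding F_def
      using convex_smooth_lower_bound[OF assms(1,3,2), of z z'] by (intro mult_left_mono) auto
    finally show ?thesis .
  qed
  have F_xstar: "F xstar = 0" "G xstar = 0" by (simp_all add: F_def fstar G_def grad0)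
  have F_y: "F (y (Suc k)) \<le> \<Phi> k" for k
  proof -
    have grad: "grad f (x k) = L *\<^sub>R G (x k)"
      using assms(2) by (simp add: G_def h2)
    have "f (y (Suc k)) \<le> f (x k) - L * (norm (G (x k)))\<^sup>2 / 2"
      using smooth_upper_bound[OF assms(3), of "x k" "- G (x k)"]
      by (simp add: y_Suc grad power2_norm_eq_inner)
    then have "F (y (Suc k)) \<le> h\<^sup>2 * (f (x k) - L * (norm (G (x k)))\<^sup>2 / 2 - fstar)"
      unfolding F_def by (intro mult_left_mono) auto
    also have "\<dots> = \<Phi> k"
      using assms(2) by (simp add: F_def \<Phi>_def h2 field_simps)
    finally show ?thesis .
  qed
  have growth': "s\<^sup>2 / (2 * \<gamma>) * (norm (y (Suc k) - xstar))\<^sup>2 \<le> \<Phi> k" for k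
  proof -
    have "h\<^sup>2 * (\<mu> / 2 * (norm (y (Suc k) - xstar))\<^sup>2) \<le> F (y (Suc k))"
      unfolding F_def by (intro mult_left_mono growth) auto
    also have "h\<^sup>2 * (\<mu> / 2 * (norm (y (Suc k) - xstar))\<^sup>2) = s\<^sup>2 / (2 * \<gamma>) * (norm (y (Suc k) - xstar))\<^sup>2"
      using gamma by (simp add: s2 assms(11) h2)
    finally show ?thesis using F_y[of k] by linarith
  qed

  define E where "E k = energy (\<Phi> k) (y (Suc k) - xstar) (w (Suc k))" for k
  define C where "C = ((1 + s)\<^sup>2 - (1 + \<rho>) * c\<^sup>2) / 2"
  have C: "0 < C" using gradient_coefficient by (simp add: C_def)
  have step: "(1 + \<rho>) * E (Suc k) + C * (norm (G (x (Suc k))))\<^sup>2 \<le> E k" for k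
  proof -
    let ?g = "G (x (Suc k))"
    have y': "y (Suc (Suc k)) - xstar = y (Suc k) - xstar + (w (Suc k) - ?g)"
      by (simp add: y_Suc[of "Suc k"] w_def)
    \<comment> \<open>The squares subtracted in \<open>\<Phi>\<close>, together with the squared
      gradient difference in \<open>F_lower\<close>, turn the increment of \<open>x\<close> into
      that of \<open>y\<close>.\<close>
    have "\<Phi> (Suc k) - \<Phi> k \<le> inner ?g (w (Suc k) - ?g)"
      using F_lower[of "x (Suc k)" "x k"]
      unfolding \<Phi>_def w_def y_Suc power2_norm_eq_inner
      by (simp add: inner_simps inner_commute field_simps)
    moreover have "\<Phi> (Suc k) \<le> inner ?g (y (Suc (Suc k)) - xstar)"
      using F_lower[of "x (Suc k)" xstar]
      unfolding \<Phi>_def y_Suc power2_norm_eq_inner F_xstar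
      by (simp add: inner_simps inner_commute field_simps)
    ultimately show ?thesis
      using energy_decrease[of "\<Phi> (Suc k)" "\<Phi> k" ?g "w (Suc k)" "y (Suc k) - xstar"] growth'[of "Suc k"]
      unfolding E_def C_def y' w_Suc[of "Suc k"] by blast
  qed
  have E_lower: "\<gamma> * (1 - \<kappa>) * \<Phi> k \<le> E k" for k
    unfolding E_def using growth' by (rule energy_lower_bound)
  have \<Phi>_nonneg: "0 \<le> \<Phi> k" for k
  proof -
    have "0 \<le> s\<^sup>2 / (2 * \<gamma>) * (norm (y (Suc k) - xstar))\<^sup>2" using gamma by simp
    then show ?thesis using growth'[of k] by linarith
  qed
  have E_nonneg: "0 \<le> E k" for k
  proof -
    have "0 \<le> \<gamma> * (1 - \<kappa>) * \<Phi> k"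
      using gamma kappa \<Phi>_nonneg by simp
    then show ?thesis using E_lower[of k] by linarith
  qed
  have E_0: "E 0 \<le> \<gamma> * (F (x 0) + q / 2 * (norm (x 0 - xstar))\<^sup>2)"
  proof -
    have k: "s / ((2 + sqrt 2) * (1 + s)) = d / (1 + s)"
    proof -
      have "1 = \<kappa> * (2 + sqrt 2)" by (simp add: kappa_alt field_simps)
      then have "1 / (2 + sqrt 2) = \<kappa>"
        using root2 by (simp only: divide_eq_eq) simp
      moreover have "s / (2 + sqrt 2) = 1 / (2 + sqrt 2) * s" by simp
      ultimately have "s / (2 + sqrt 2) = d" by (simp only: d_def)
      then show ?thesis by (metis divide_divide_eq_left)
    qed
    \<comment> \<open>This is the choice of \<open>y 0\<close>, rewritten. It makes
      \<open>(1 + s) *\<^sub>R w 1 = s *\<^sub>R G (x 0)\<close>, so the first velocity depends on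
      \<open>x 0 - xstar\<close> alone.\<close>
    have "w 0 = (\<gamma> - d / (1 + s)) *\<^sub>R G (x 0)"
      using assms(15) by (simp add: w_def G_def s_def[symmetric] k)
    then have "w 0 - G (x 0) - \<gamma> *\<^sub>R G (x 0) = (\<gamma> - d / (1 + s) - 1 - \<gamma>) *\<^sub>R G (x 0)"
      by (simp add: scaleR_left_diff_distrib)
    moreover have "\<gamma> - d / (1 + s) - 1 - \<gamma> = - ((1 + s + d) / (1 + s))"
      using s_pos by (simp add: add_divide_distrib)
    ultimately have "w 0 - G (x 0) - \<gamma> *\<^sub>R G (x 0) = (- ((1 + s + d) / (1 + s))) *\<^sub>R G (x 0)"
      by (simp only:)
    then have "w 1 = (- (1 / (1 + s))) *\<^sub>R G (x 0) + G (x 0)"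
      using w_Suc[of 0] s_pos d_pos by simp
    then have "(1 + s) *\<^sub>R w 1 = s *\<^sub>R G (x 0)"
      using s_pos by (simp add: scaleR_add_right) (simp add: algebra_simps)
    then have "s *\<^sub>R (y 1 - xstar) + (1 + s) *\<^sub>R w 1 = s *\<^sub>R (y 1 + G (x 0) - xstar)"
      by (simp only: scaleR_add_right scaleR_diff_right) simp
    then have v: "s *\<^sub>R (y 1 - xstar) + (1 + s) *\<^sub>R w 1 = s *\<^sub>R (x 0 - xstar)"
      using y_Suc[of 0] by simp
    have "E 0 \<le> \<gamma> * \<Phi> 0 + (norm (s *\<^sub>R (y 1 - xstar) + (1 + s) *\<^sub>R w 1))\<^sup>2 / 2"
      using energy_upper_bound[OF \<Phi>_nonneg[of 0], of "y 1 - xstar" "w 1"]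
      by (simp only: E_def One_nat_def)
    \<comment> \<open>Since \<open>s\<^sup>2 = q * \<gamma>\<close>, both terms carry the factor
      \<open>\<gamma>\<close>, which later cancels against the one in
      \<open>E_lower\<close>.\<close>
    also have "\<dots> = \<gamma> * \<Phi> 0 + \<gamma> * (q / 2 * (norm (x 0 - xstar))\<^sup>2)"
      unfolding v using s_pos by (simp add: power_mult_distrib s2)
    also have "\<dots> \<le> \<gamma> * F (x 0) + \<gamma> * (q / 2 * (norm (x 0 - xstar))\<^sup>2)"
      using gamma by (intro add_right_mono mult_left_mono) (auto simp: \<Phi>_def)
    finally show ?thesis by (simp add: distrib_left)
  qed

  have rho: "0 < 1 + \<rho>" using rho_pos by simp
  note decay = weighted_decrease[of "1 + \<rho>" E "\<lambda>k. C * (norm (G (x (Suc k))))\<^sup>2", OF _ step E_nonneg]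
  have rate: "f (y (Suc k)) - fstar
      \<le> (sqrt 2 * \<mu> / 2 * (norm (x 0 - xstar))\<^sup>2 + sqrt 2 * (f (x 0) - fstar)) * (1 + \<rho>) powi (- int k)" for k
  proof -
    have "\<gamma> * (1 - \<kappa>) * F (y (Suc k)) \<le> \<gamma> * (1 - \<kappa>) * \<Phi> k"
      using F_y gamma kappa by (intro mult_left_mono) auto
    also have "\<dots> \<le> E k" by (rule E_lower)
    also have "\<dots> \<le> E 0 / (1 + \<rho>) ^ k"
      using decay(1)[of k] C rho by (simp add: pos_le_divide_eq mult.commute)
    also have "\<dots> \<le> \<gamma> * (F (x 0) + q / 2 * (norm (x 0 - xstar))\<^sup>2) / (1 + \<rho>) ^ k"
      using E_0 rho by (intro divide_right_mono) auto
    finally have "(1 - \<kappa>) * F (y (Suc k)) \<le> (F (x 0) + q / 2 * (norm (x 0 - xstar))\<^sup>2) / (1 + \<rho>) ^ k"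
      using gamma by (simp add: mult.assoc flip: times_divide_eq_right)
    \<comment> \<open>The factor \<open>L\<close> undoes the scaling of \<open>F\<close>, and
      \<open>sqrt 2\<close> is the inverse of \<open>1 - \<kappa>\<close>.\<close>
    then have "L * sqrt 2 * ((1 - \<kappa>) * F (y (Suc k)))
        \<le> L * sqrt 2 * ((F (x 0) + q / 2 * (norm (x 0 - xstar))\<^sup>2) / (1 + \<rho>) ^ k)"
      using assms(2) by (intro mult_left_mono) auto
    also have "\<dots> = L * sqrt 2 * (F (x 0) + q / 2 * (norm (x 0 - xstar))\<^sup>2) * (1 + \<rho>) powi (- int k)"
      by (simp only: power_int_minus power_int_of_nat divide_inverse mult.assoc)
    finally have *: "L * sqrt 2 * ((1 - \<kappa>) * F (y (Suc k)))
        \<le> L * sqrt 2 * (F (x 0) + q / 2 * (norm (x 0 - xstar))\<^sup>2) * (1 + \<rho>) powi (- int k)" .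
    have lhs: "L * sqrt 2 * ((1 - \<kappa>) * F (y (Suc k))) = f (y (Suc k)) - fstar"
      using assms(2) by (simp add: \<kappa>_def F_def h2)
    have rhs: "L * sqrt 2 * (F (x 0) + q / 2 * (norm (x 0 - xstar))\<^sup>2)
        = sqrt 2 * \<mu> / 2 * (norm (x 0 - xstar))\<^sup>2 + sqrt 2 * (f (x 0) - fstar)"
      using assms(2) by (simp add: F_def h2 assms(11) field_simps)
    show ?thesis using * unfolding lhs rhs .
  qed
  have "summable (\<lambda>k. (1 + \<rho>) ^ k * (C * (norm (G (x (Suc k))))\<^sup>2))"
    using decay(2) C rho by simp
  \<comment> \<open>The decrease of \<open>E k\<close> involves the gradient at
    \<open>x (Suc k)\<close>, so the series starts at index 1; the factor restores the weight
    \<open>(1 + \<rho>) ^ Suc k\<close> and the unscaled gradient.\<close>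
  then have "summable (\<lambda>k. (1 + \<rho>) * L\<^sup>2 / C * ((1 + \<rho>) ^ k * (C * (norm (G (x (Suc k))))\<^sup>2)))"
    by (rule summable_mult)
  moreover have "(1 + \<rho>) * L\<^sup>2 / C * ((1 + \<rho>) ^ k * (C * (norm (G (x (Suc k))))\<^sup>2))
      = (1 + \<rho>) ^ Suc k * (norm (grad f (x (Suc k))))\<^sup>2" for k
    using C assms(2) by (simp add: G_def h2 power_mult_distrib power_divide)
  ultimately have "summable (\<lambda>k. (1 + \<rho>) ^ Suc k * (norm (grad f (x (Suc k))))\<^sup>2)"
    by (simp only:)
  then have "summable (\<lambda>k. (1 + \<rho>) ^ k * (norm (grad f (x k)))\<^sup>2)"
    by (rule summable_Suc_iff[of "\<lambda>k. (1 + \<rho>) ^ k * (norm (grad f (x k)))\<^sup>2", THEN iffD1])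
  moreover have "\<forall>k\<ge>1. f (y k) - fstar
      \<le> (sqrt 2 * \<mu> / 2 * (norm (x 0 - xstar))\<^sup>2 + sqrt 2 * (f (x 0) - fstar)) * (1 + \<rho>) powi (- int k + 1)"
  proof (intro allI impI)
    fix k :: nat assume "k \<ge> 1"
    \<comment> \<open>\<open>E 0\<close> already belongs to \<open>y 1\<close>, so
      \<open>y k\<close> has seen only \<open>k - 1\<close> contractions.\<close>
    then obtain j where j: "k = Suc j" by (cases k) auto
    have exponent: "- int k + 1 = - int j" by (simp add: j)
    show "f (y k) - fstar
      \<le> (sqrt 2 * \<mu> / 2 * (norm (x 0 - xstar))\<^sup>2 + sqrt 2 * (f (x 0) - fstar)) * (1 + \<rho>) powi (- int k + 1)"
      unfolding exponent unfolding j by (rule rate)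
  qed
  ultimately show ?thesis by (intro conjI)
qed

end
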